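(* Assume that for every integer $m\ge1$ and every $m$ distinct integers $a_1,\dots,a_m$, $\sum_{n\le N}\boldsymbol\lambda(n+a_1)\cdots\boldsymbol\lambda(n+a_m)=o(N)$ as $N\to\infty$. Let $X_{\boldsymbol\lambda}$ be the closure of the orbit of the point $(\boldsymbol\lambda(n))_{n\ge1}\in\{-1,1\}^{\mathbb N}$ under the shift $S$, and let $\mathbb P$ be a weak-* limit point of the empirical measures $\frac1N\sum_{j=1}^N\delta_{S^j\boldsymbol\lambda}$. Then for every $p\ge1$, $$\int_{X_{\boldsymbol\lambda}}\Big\|\frac1{\sqrt N}\sum_{j=1}^Nx_jz^j\Big\|_{L^p(S^1,dz)}^p\,d\mathbb P(x)\longrightarrow\Gamma\Big(\frac p2+1\Big)\quad(N\to\infty);$$ in particular, for $p=4$ the limit is $\Gamma(3)=2$.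
   Context: $\boldsymbol\lambda$ is the Liouville function; $S^1$ is the unit circle with normalized Lebesgue measure $dz$; $x=(x_j)_{j\ge1}$ denotes a point of $X_{\boldsymbol\lambda}$; $\Gamma$ is the gamma function. *)

theory Defs
  imports
    "HOL-Probability.Probability"
    "HOL-Computational_Algebra.Primes"
    "HOL-Library.Landau_Symbols"
begin

text \<open>The size of the prime factorization multiset is the number of prime factors counted with
  multiplicity. The value at 0 is a convention; it also stands for all nonpositive integers
  when the argument is a truncated \<^term>\<open>nat k\<close>, and affects only finitely many terms
  of a correlation sum.\<close>

definition liouville :: "nat \<Rightarrow> real" where
  "liouville n = (if n = 0 then 0 else (- 1) ^ size (prime_factorization n))"

text \<open>A sequence $(x_j)_{j\ge 1}$ is encoded as a function \<^term>\<open>x :: nat \<Rightarrow> real\<close>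
  with $x_j$ stored at position \<^term>\<open>j - 1\<close>.\<close>

definition liouville_point :: "nat \<Rightarrow> real" where
  "liouville_point i = liouville (Suc i)"

definition shift :: "(nat \<Rightarrow> 'a) \<Rightarrow> nat \<Rightarrow> 'a" where
  "shift x i = x (Suc i)"

text \<open>The closure is taken in $\mathbb{R}^{\mathbb{N}}$ with the product topology; as
  $\{-1,1\}^{\mathbb{N}}$ is closed there, it is the same as the closure in
  $\{-1,1\}^{\mathbb{N}}$.\<close>

definition liouville_system :: "(nat \<Rightarrow> real) set" where
  "liouville_system = closure (range (\<lambda>n. (shift ^^ n) liouville_point))"

text \<open>The push-forward of the uniform probability measure on $\{1,\dots,N\}$ under
  $j \mapsto S^j\lambda$ is $\frac1N\sum_{j=1}^N\delta_{S^j\lambda}$.\<close>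

definition empirical_measure :: "nat \<Rightarrow> (nat \<Rightarrow> real) measure" where
  "empirical_measure N =
     distr (uniform_count_measure {1..N}) (restrict_space borel liouville_system)
       (\<lambda>j. (shift ^^ j) liouville_point)"

text \<open>Cluster points of a sequence of measures on a compact space \<^term>\<open>X\<close>: every basic weak-*
  neighbourhood, given by finitely many continuous functions and some \<^term>\<open>e > (0::real)\<close>,
  contains \<^term>\<open>\<mu> N\<close> for infinitely many \<^term>\<open>N\<close>.\<close>

definition weak_star_limit_point ::
  "'a::topological_space set \<Rightarrow> (nat \<Rightarrow> 'a measure) \<Rightarrow> 'a measure \<Rightarrow> bool" where
  "weak_star_limit_point X \<mu> P \<longleftrightarrow>
     prob_space P \<and> sets P = sets (restrict_space borel X) \<and>
     (\<forall>F :: ('a \<Rightarrow> real) set. \<forall>e>0. finite F \<longrightarrow> (\<forall>f\<in>F. continuous_on X f) \<longrightarrow>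
        (\<exists>\<^sub>F N in sequentially. \<forall>f\<in>F. \<bar>(LINT x|\<mu> N. f x) - (LINT x|P. f x)\<bar> < e))"

definition circle_measure :: "complex measure" where
  "circle_measure =
     distr (uniform_measure lborel {0..1::real}) (restrict_space borel (sphere 0 1))
       (\<lambda>t. cis (2 * pi * t))"

definition Lp_norm :: "real \<Rightarrow> 'a measure \<Rightarrow> ('a \<Rightarrow> complex) \<Rightarrow> real" where
  "Lp_norm p M f = (LINT z|M. norm (f z) powr p) powr (1 / p)"

lemma orbit_in_liouville_system: "(shift ^^ n) liouville_point \<in> liouville_system"
  unfolding liouville_system_def by (rule subsetD[OF closure_subset]) simp

lemma integral_empirical_measure:
  fixes f :: "(nat \<Rightarrow> real) \<Rightarrow> real"
  assumes "continuous_on liouville_system f"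
  shows "(LINT x|empirical_measure N. f x) =
           (\<Sum>j=1..N. f ((shift ^^ j) liouville_point)) / real N"
proof -
  have "(\<lambda>j. (shift ^^ j) liouville_point)
          \<in> uniform_count_measure {1..N} \<rightarrow>\<^sub>M restrict_space borel liouville_system"
    using orbit_in_liouville_system
    by (auto simp: measurable_def space_uniform_count_measure sets_uniform_count_measure
          space_restrict_space)
  moreover have "f \<in> borel_measurable (restrict_space borel liouville_system)"
    using assms by (rule borel_measurable_continuous_on_restrict)
  ultimately have "(LINT x|empirical_measure N. f x) =
      (LINT j|uniform_count_measure {1..N}. f ((shift ^^ j) liouville_point))"
    unfolding empirical_measure_def by (rule integral_distr)
  also have "\<dots> = (\<Sum>j=1..N. f ((shift ^^ j) liouville_point)) / real N"
    unfolding uniform_count_measure_def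
    by (subst lebesgue_integral_point_measure_finite) (auto simp: sum_divide_distrib)
  finally show ?thesis .
qed

end

theory Submission
  imports Defs
begin

text \<open>Chowla's conjecture says that under the limit measure every nonempty product of distinct
  coordinates has mean zero, so the expectation of a product of factors $c_j + x_j d_j$ is
  $\prod_j c_j$. This computes exponential moments and characteristic functions of linear forms
  in $x$ exactly as for independent fair signs.

  To reduce the normalized sum $S_N(z)$ to a real random variable, it is projected onto a
  line in a uniformly random direction: averaging $|\mathrm{Im}(w e^{i\pi\theta})|^p$ over
  $\theta\in[0,1]$ gives $|w|^p$ times a Beta constant. On the product of the system, the circle
  and the space of directions, the projection of $\sqrt2\,S_N(z)$ has characteristic function equal
  to the mean of a product of cosines, which tends to $e^{-s^2/2}$ because the squares of the
  coefficients sum to $1$ in the limit for almost every $z$. Levy's continuity theorem gives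
  convergence to the normal law, uniformly bounded exponential moments upgrade this to convergence
  of $p$-th absolute moments, and the Beta constant cancels against the normal moment by Legendre's
  duplication formula, leaving
  $\Gamma(p/2+1)$.\<close>

section \<open>Sine integrals and normal moments\<close>

lemma has_bochner_integral_lborel_if_has_integral:
  fixes f :: "real \<Rightarrow> real"
  assumes "(f has_integral I) A" "f \<in> borel_measurable borel" "A \<in> sets borel"
    and nn: "\<And>x. x \<in> A \<Longrightarrow> 0 \<le> f x"
  shows "has_bochner_integral lborel (\<lambda>x. indicator A x * f x) I"
proof (rule has_bochner_integral_nn_integral)
  show "(\<integral>\<^sup>+ x. ennreal (indicator A x * f x) \<partial>lborel) = ennreal I"
    using nn_integral_has_integral_lebesgue[OF nn assms(1)] .
  show "0 \<le> I"
    using assms(1) nn by (rule has_integral_nonneg)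
qed (use assms in \<open>auto simp: indicator_def\<close>)

text \<open>For a nonnegative integrand, integrability is absolute integrability, which is what the
  change-of-variables theorem for injective maps requires.\<close>

lemma has_integral_substitution_nonneg_real:
  fixes f g g' :: "real \<Rightarrow> real"
  assumes "(f has_integral I) (g ` A)" "A \<in> sets borel"
    and "\<And>x. x \<in> A \<Longrightarrow> (g has_field_derivative g' x) (at x)" "inj_on g A"
    and "\<And>x. x \<in> g ` A \<Longrightarrow> 0 \<le> f x"
  shows "((\<lambda>x. \<bar>g' x\<bar> * f (g x)) has_integral I) A"
proof -
  have "f absolutely_integrable_on g ` A"
    using assms by (intro nonnegative_absolutely_integrable_1) (auto simp: has_integral_iff)
  with assms(1) have "(\<lambda>x. \<bar>g' x\<bar> * f (g x)) absolutely_integrable_on A \<and>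
      integral A (\<lambda>x. \<bar>g' x\<bar> * f (g x)) = I"
    using assms(2-4)
    by (subst has_absolute_integral_change_of_variables_1')
      (auto simp: has_integral_iff intro: has_field_derivative_at_within)
  then show ?thesis
    by (auto simp: has_integral_iff dest: set_lebesgue_integral_eq_integral(1))
qed

text \<open>The substitution t = y^2 / 2 turns the moment over the positive half-line into a Gamma
  integral, and evenness of the integrand doubles it.\<close>

lemma std_normal_abs_moment:
  fixes p :: real
  assumes "p > 0"
  shows "has_bochner_integral lborel (\<lambda>y. std_normal_density y * \<bar>y\<bar> powr p)
           (2 powr (p / 2) * Gamma ((p + 1) / 2) / sqrt pi)"
proof -
  let ?f = "\<lambda>t::real. t powr ((p + 1) / 2 - 1) / exp t"
  have image: "(\<lambda>y. y\<^sup>2 / 2) ` {0<..} = {0::real<..}"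
  proof (safe intro!: image_eqI)
    fix y :: real assume "y > 0"
    then show "y = (sqrt (2 * y))\<^sup>2 / 2" "0 < sqrt (2 * y)" by auto
  qed auto
  have inj: "inj_on (\<lambda>y::real. y\<^sup>2 / 2) {0<..}"
    by (rule inj_onI) (auto simp: power2_eq_iff)
  have "(?f has_integral Gamma ((p + 1) / 2)) {0..}"
    using assms by (intro Gamma_integral_real) auto
  then have "(?f has_integral Gamma ((p + 1) / 2)) {0<..}"
    by (rule has_integral_spike_set_eq[THEN iffD1, rotated -1])
      (auto intro: negligible_subset[of "{0}"])
  then have "((\<lambda>y. \<bar>y\<bar> * ?f (y\<^sup>2 / 2)) has_integral Gamma ((p + 1) / 2)) {0<..}"
    by (intro has_integral_substitution_nonneg_real[where g' = "\<lambda>y. y"] inj)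
      (auto simp: image intro!: derivative_eq_intros)
  \<comment> \<open>The factor combines 1 / sqrt (2 pi) from the density with 2 powr ((p - 1) / 2),
    which comes from writing y powr (p - 1) as a power of y^2 / 2.\<close>
  then have *: "((\<lambda>y. 2 powr (p / 2) / (2 * sqrt pi) * (\<bar>y\<bar> * ?f (y\<^sup>2 / 2)))
      has_integral 2 powr (p / 2) / (2 * sqrt pi) * Gamma ((p + 1) / 2)) {0<..}"
    by (rule has_integral_mult_right)
  have eq: "2 powr (p / 2) / (2 * sqrt pi) * (\<bar>y\<bar> * ?f (y\<^sup>2 / 2)) =
      std_normal_density y * \<bar>y\<bar> powr p" if "y > 0" for y :: real
  proof -
    have "(y\<^sup>2 / 2) powr ((p + 1) / 2 - 1) = y powr (p - 1) / 2 powr ((p - 1) / 2)"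
      using that by (simp add: powr_divide power2_eq_square powr_mult diff_divide_distrib add_divide_distrib
        flip: powr_add)
    moreover have "2 powr (p / 2) = sqrt 2 * 2 powr ((p - 1) / 2)"
      by (simp add: powr_half_sqrt[symmetric] diff_divide_distrib flip: powr_add)
    moreover have "y * y powr (p - 1) = y powr p"
      using that by (simp add: powr_diff)
    moreover have [simp]: "sqrt 2 * (sqrt 2 * x) = 2 * x" for x :: real
      by (simp flip: mult.assoc)
    ultimately show ?thesis
      using that by (simp add: std_normal_density_def exp_minus real_sqrt_mult field_simps)
  qed
  have "((\<lambda>y. std_normal_density y * \<bar>y\<bar> powr p)
      has_integral 2 powr (p / 2) / (2 * sqrt pi) * Gamma ((p + 1) / 2)) {0<..}"
    by (rule has_integral_eq[OF _ *]) (use eq in auto)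
  then have "((\<lambda>y. std_normal_density y * \<bar>y\<bar> powr p)
      has_integral 2 powr (p / 2) / (2 * sqrt pi) * Gamma ((p + 1) / 2)) {0..}"
    by (rule has_integral_spike_set_eq[THEN iffD1, rotated -1])
      (auto intro: negligible_subset[of "{0}"])
  then have "has_bochner_integral lborel (\<lambda>y. indicator {0..} y *\<^sub>R (std_normal_density y * \<bar>y\<bar> powr p))
      (2 powr (p / 2) / (2 * sqrt pi) * Gamma ((p + 1) / 2))"
    unfolding real_scaleR_def
    by (intro has_bochner_integral_lborel_if_has_integral) auto
  from has_bochner_integral_even_function[OF this] show ?thesis
    by (simp add: normal_density_def field_simps)
qed

text \<open>This is the complex Legendre duplication formula at (p + 1) / 2. All the values are real
  there, so the identity descends to the reals.\<close>

lemma Gamma_duplication_real: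
  fixes p :: real
  assumes "p > 0"
  shows "Gamma ((p + 1) / 2) * Gamma (p / 2 + 1) = 2 powr (- p) * sqrt pi * Gamma (p + 1)"
proof -
  have "complex_of_real ((p + 1) / 2) \<notin> \<int>\<^sub>\<le>\<^sub>0" "complex_of_real ((p + 1) / 2) + 1 / 2 \<notin> \<int>\<^sub>\<le>\<^sub>0"
    using assms by (auto elim!: nonpos_Ints_cases' simp: complex_eq_iff field_simps)
  from Gamma_legendre_duplication[OF this]
  have "complex_of_real (Gamma ((p + 1) / 2) * Gamma (p / 2 + 1)) =
      exp ((1 - 2 * complex_of_real ((p + 1) / 2)) * complex_of_real (ln 2)) * of_real (sqrt pi) * Gamma (of_real (p + 1))"
    by (simp add: add_divide_distrib add.assoc flip: Gamma_complex_of_real)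
  also have "\<dots> = complex_of_real (exp (- p * ln 2) * sqrt pi * Gamma (p + 1))"
    unfolding of_real_mult exp_of_real[symmetric] Gamma_complex_of_real
    by (simp add: field_simps)
  finally show ?thesis
    by (simp only: of_real_eq_iff powr_def) simp
qed

text \<open>A half-angle substitution leads to the Beta integral with both parameters equal to (p +
  1) / 2, and the duplication formula then trades \<open>Gamma (p + 1)\<close> for
  \<open>Gamma (p / 2 + 1)\<close>. This value is the constant lost when a complex modulus is
  replaced by its projection onto a random line.\<close>

lemma has_integral_sin_powr:
  fixes p :: real
  assumes "p > 0"
  shows "((\<lambda>\<theta>. sin (pi * \<theta>) powr p) has_integral
           Gamma ((p + 1) / 2) / (sqrt pi * Gamma (p / 2 + 1))) {0<..<1}"
proof -
  let ?a = "(p + 1) / 2"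
  let ?f = "\<lambda>t::real. t powr (?a - 1) * (1 - t) powr (?a - 1)"
  \<comment> \<open>Chosen since \<open>sin (pi * \<theta>)\<^sup>2 = 4 * ?g \<theta> * (1 - ?g \<theta>)\<close> and it is monotone on the whole interval.\<close>
  let ?g = "\<lambda>\<theta>. (1 - cos (pi * \<theta>)) / 2"
  have inj: "inj_on ?g {0<..<1}"
    by (rule inj_onI) (auto dest!: cos_inj_pi[rotated -1])
  have image: "?g ` {0<..<1} = {0<..<1}"
  proof (safe intro!: image_eqI)
    fix x :: real assume x: "x \<in> {0<..<1}"
    show "?g x \<in> {0<..<1}"
      using cos_monotone_0_pi[of 0 "pi * x"] cos_monotone_0_pi[of "pi * x" pi] x by auto
  next
    fix y :: real assume y: "y \<in> {0<..<1}"
    show "y = ?g (arccos (1 - 2 * y) / pi)" "arccos (1 - 2 * y) / pi \<in> {0<..<1}"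
      using y arccos_lt_bounded[of "1 - 2 * y"] by (auto simp: cos_arccos)
  qed
  have "(?f has_integral Beta ?a ?a) {0<..<1}"
    using has_integral_Beta_real[of ?a ?a] assms by (simp add: has_integral_Icc_iff_Ioo)
  then have "((\<lambda>\<theta>. \<bar>pi * sin (pi * \<theta>) / 2\<bar> * ?f (?g \<theta>)) has_integral Beta ?a ?a) {0<..<1}"
    by (intro has_integral_substitution_nonneg_real inj)
      (auto simp: image intro!: derivative_eq_intros)
  \<comment> \<open>With s the sine, the derivative contributes pi * s / 2 and the Beta integrand (s
    / 2) powr (p - 1); the product is pi / 2 powr p times s powr p.\<close>
  then have *: "((\<lambda>\<theta>. 2 powr p / pi * (\<bar>pi * sin (pi * \<theta>) / 2\<bar> * ?f (?g \<theta>))) has_integral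
      2 powr p / pi * Beta ?a ?a) {0<..<1}"
    by (rule has_integral_mult_right)
  have eq: "2 powr p / pi * (\<bar>pi * sin (pi * \<theta>) / 2\<bar> * ?f (?g \<theta>)) = sin (pi * \<theta>) powr p"
    if "\<theta> \<in> {0<..<1}" for \<theta>
  proof -
    let ?s = "sin (pi * \<theta>)"
    have s: "?s > 0" using that by (intro sin_gt_zero) auto
    have "?f (?g \<theta>) = (?g \<theta> * (1 - ?g \<theta>)) powr (?a - 1)"
      by (subst powr_mult) (auto simp: field_simps)
    also have "?g \<theta> * (1 - ?g \<theta>) = (?s / 2) powr 2"
      using s by (simp add: field_simps sin_squared_eq) (simp add: power2_eq_square)
    also have "\<dots> powr (?a - 1) = (?s / 2) powr (p - 1)"
      unfolding powr_powr by (simp add: diff_divide_distrib)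
    also have "\<dots> = ?s powr p / 2 powr p * 2 / ?s"
      using s by (simp add: powr_diff powr_divide)
    finally show ?thesis
      using s by (simp add: field_simps)
  qed
  have "2 powr p / pi * Beta ?a ?a = Gamma ?a / (sqrt pi * Gamma (p / 2 + 1))"
  proof -
    have "Gamma (p + 1) > 0" "Gamma (p / 2 + 1) > 0" "Gamma ?a > 0"
      using assms by (auto intro!: Gamma_real_pos)
    moreover have "Beta ?a ?a * Gamma (p + 1) = Gamma ?a * Gamma ?a"
      using \<open>Gamma (p + 1) > 0\<close> unfolding Beta_def field_sum_of_halves by simp
    moreover have "sqrt pi * Gamma (p + 1) = 2 powr p * (Gamma ?a * Gamma (p / 2 + 1))"
      using Gamma_duplication_real[OF assms] by (simp add: powr_minus)
    moreover have "sqrt pi * sqrt pi = pi"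
      by simp
    ultimately have "2 powr p * Beta ?a ?a * (sqrt pi * Gamma (p / 2 + 1)) * Gamma (p + 1) =
        Gamma ?a * pi * Gamma (p + 1)"
      by algebra
    then show ?thesis
      using \<open>Gamma (p + 1) > 0\<close> \<open>Gamma (p / 2 + 1) > 0\<close> by (simp add: frac_eq_eq)
  qed
  with * show ?thesis
    by (auto intro: has_integral_eq[OF eq])
qed

section \<open>Averaging a projection over all directions\<close>

lemma has_integral_shift_periodic:
  fixes f :: "real \<Rightarrow> real"
  assumes f: "continuous_on UNIV f" "\<And>x. f (x + 1) = f x" and c: "0 \<le> c" "c \<le> 1"
    and I: "(f has_integral I) {0..1}"
  shows "((\<lambda>x. f (x + c)) has_integral I) {0..1}"
proof -
  have int: "f integrable_on {a..b}" for a b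
    by (rule integrable_continuous_interval) (rule continuous_on_subset[OF f(1)], simp)
  \<comment> \<open>By periodicity the piece over \<open>{0..c}\<close> moves one period to the
    right, where it continues the piece over \<open>{c..1}\<close>.\<close>
  have "((\<lambda>x. f (1 + x)) has_integral integral {0..c} f) {0..c}"
    using integrable_integral[OF int] f(2) by (simp add: add.commute)
  then have "(f has_integral integral {0..c} f) {1..c + 1}"
    using has_integral_shift_Icc_real[of f 1 _ 0 c] by (simp add: o_def)
  moreover have "(f has_integral integral {c..1} f) {c..1}"
    using int by (rule integrable_integral)
  ultimately have "(f has_integral integral {c..1} f + integral {0..c} f) {c..1 + c}"
    using c by (intro has_integral_combine[of c 1]) (auto simp: add.commute)
  also have "integral {c..1} f + integral {0..c} f = I"
    using Henstock_Kurzweil_Integration.integral_combine[OF c int] I by (simp add: integral_unique add.commute)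
  finally show ?thesis
    using has_integral_shift_Icc_real[of f c I 0 1] by (simp add: o_def add.commute)
qed

text \<open>In polar form the argument of w only shifts the sine, and the absolute value of sin (pi
  * x) has period 1, so the integral over a full period depends on w only through its
  modulus.\<close>

lemma has_integral_Im_rotation_powr:
  fixes p :: real and w :: complex
  assumes "p > 0"
  shows "((\<lambda>\<theta>. \<bar>Im (w * cis (pi * \<theta>))\<bar> powr p) has_integral
           norm w powr p * (Gamma ((p + 1) / 2) / (sqrt pi * Gamma (p / 2 + 1)))) {0..1}"
    (is "(_ has_integral _ * ?K) _")
proof -
  let ?h = "\<lambda>\<theta>. \<bar>sin (pi * \<theta>)\<bar> powr p"
  \<comment> \<open>The radius r may be negative: a negative argument is raised by a half turn,
    which flips the sign of r and keeps c within one period.\<close>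
  obtain r c where w: "w = complex_of_real r * cis (pi * c)" and c: "0 \<le> c" "c \<le> 1"
  proof (cases "Arg w \<ge> 0")
    case True
    show ?thesis
      by (rule that[of "norm w" "Arg w / pi"])
        (use True Arg_bounded[of w] rcis_cmod_Arg[of w] in \<open>simp_all add: rcis_def\<close>)
  next
    case False
    have "w = - (complex_of_real (norm w) * cis (Arg w + pi))"
      using rcis_cmod_Arg[of w] by (simp add: rcis_def flip: cis_mult)
    then show ?thesis
      using False Arg_bounded[of w]
      by (intro that[of "- norm w" "Arg w / pi + 1"]) (simp_all add: distrib_left divide_nonpos_pos, simp add: field_simps)
  qed
  have "((\<lambda>\<theta>. sin (pi * \<theta>) powr p) has_integral ?K) {0..1}"
    using has_integral_sin_powr[OF assms] by (simp add: has_integral_Icc_iff_Ioo)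
  then have "(?h has_integral ?K) {0..1}"
    by (rule has_integral_eq[rotated]) (auto simp: sin_ge_zero)
  then have "((\<lambda>\<theta>. ?h (\<theta> + c)) has_integral ?K) {0..1}"
  proof (rule has_integral_shift_periodic[of ?h, OF _ _ c, rotated -1])
    show "continuous_on UNIV ?h"
      using assms by (intro continuous_on_powr' continuous_intros) auto
  qed (simp add: distrib_left)
  then have "((\<lambda>\<theta>. \<bar>r\<bar> powr p * ?h (\<theta> + c)) has_integral \<bar>r\<bar> powr p * ?K) {0..1}"
    by (rule has_integral_mult_right)
  moreover have "\<bar>Im (w * cis (pi * \<theta>))\<bar> powr p = \<bar>r\<bar> powr p * ?h (\<theta> + c)" for \<theta>
  proof -
    have "w * cis (pi * \<theta>) = complex_of_real r * cis (pi * (\<theta> + c))"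
      unfolding w by (simp add: cis_mult algebra_simps)
    then show ?thesis by (simp add: abs_mult powr_mult)
  qed
  moreover have "norm w = \<bar>r\<bar>"
    by (simp add: w norm_mult)
  ultimately show ?thesis by simp
qed

section \<open>Integration over the unit interval and the circle\<close>

abbreviation unit_uniform :: "real measure" where
  "unit_uniform \<equiv> uniform_measure lborel {0..1}"

lemma prob_space_unit_uniform: "prob_space unit_uniform"
  by (rule prob_space_uniform_measure) auto

lemma integral_unit_uniform:
  fixes f :: "real \<Rightarrow> real"
  assumes "(f has_integral I) {0..1}" "f \<in> borel_measurable borel" "\<And>x. 0 \<le> f x"
  shows "(LINT x|unit_uniform. f x) = I"
proof -
  have "unit_uniform = density lborel (indicator {0..1::real})"
    unfolding uniform_measure_def by (rule density_cong) (auto simp: divide_ennreal_def)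
  also have "\<dots> = density lborel (\<lambda>x. ennreal (indicator {0..1::real} x))"
    by (simp add: ennreal_indicator)
  finally have "(LINT x|unit_uniform. f x) = (LINT x|lborel. indicator {0..1} x * f x)"
    using assms(2) by (simp add: integral_density)
  also have "\<dots> = I"
    using assms by (intro has_bochner_integral_integral_eq has_bochner_integral_lborel_if_has_integral) auto
  finally show ?thesis .
qed

lemma integral_circle_measure:
  fixes f :: "complex \<Rightarrow> real"
  assumes [measurable]: "f \<in> borel_measurable borel"
  shows "(LINT z|circle_measure. f z) = (LINT t|unit_uniform. f (cis (2 * pi * t)))"
  unfolding circle_measure_def
  by (rule integral_distr) (auto intro!: measurable_restrict_space2 measurable_restrict_space1 simp: cis_conv_exp)

section \<open>Convergence of moments and of characteristic functions\<close>

text \<open>Raise t <= exp t, at t = |y| / q, to the power q. This converts a bound on exponential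
  moments into bounds on all absolute moments.\<close>

lemma powr_le_exp_abs:
  fixes q :: real
  assumes "q > 0"
  shows "\<bar>y\<bar> powr q \<le> q powr q * exp \<bar>y\<bar>"
proof (cases "y = 0")
  case False
  have "\<bar>y\<bar> / q \<le> exp (\<bar>y\<bar> / q)"
    using exp_ge_add_one_self[of "\<bar>y\<bar> / q"] by linarith
  then have "(\<bar>y\<bar> / q) powr q \<le> exp (\<bar>y\<bar> / q) powr q"
    using assms by (intro powr_mono2) auto
  also have "\<dots> = exp \<bar>y\<bar>"
    using assms by (simp add: powr_def)
  finally show ?thesis
    using assms by (simp add: powr_divide field_simps)
qed auto

text \<open>Where a = |f| powr p exceeds K, one has a <= a^2 / K, so truncating at K costs at most
  the 2p-th moment divided by K. This is the uniform integrability estimate in quantitative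
  form.\<close>

lemma expectation_truncated_powr:
  fixes p K :: real
  assumes "prob_space M" "f \<in> borel_measurable M" "p > 0" "K > 0"
    and int: "integrable M (\<lambda>x. \<bar>f x\<bar> powr (2 * p))"
  shows "integrable M (\<lambda>x. \<bar>f x\<bar> powr p)"
    and "\<bar>(LINT x|M. \<bar>f x\<bar> powr p) - (LINT x|M. min (\<bar>f x\<bar> powr p) K)\<bar>
           \<le> (LINT x|M. \<bar>f x\<bar> powr (2 * p)) / K"
proof -
  interpret prob_space M by fact
  note [measurable] = assms(2)
  have sq: "\<bar>f x\<bar> powr (2 * p) = (\<bar>f x\<bar> powr p)\<^sup>2" for x
    by (simp add: power2_eq_square flip: powr_add)
  have le: "a \<le> 1 + a\<^sup>2" for a :: real
    using zero_le_power2[of "a - 1 / 2"] by (simp add: power2_eq_square algebra_simps)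
  show *: "integrable M (\<lambda>x. \<bar>f x\<bar> powr p)"
    by (rule Bochner_Integration.integrable_bound[of M "\<lambda>x. 1 + \<bar>f x\<bar> powr (2 * p)"])
      (use int le in \<open>auto simp: sq\<close>)
  have **: "integrable M (\<lambda>x. min (\<bar>f x\<bar> powr p) K)"
    using assms by (intro integrable_const_bound[of _ K]) (auto simp: min_def)
  have bd: "\<bar>a - min a K\<bar> \<le> a\<^sup>2 / K" if "a \<ge> 0" for a :: real
  proof (cases "a \<le> K")
    case False
    then have "a * K \<le> a * a" using that by (intro mult_left_mono) auto
    then have "a \<le> a\<^sup>2 / K"
      using \<open>K > 0\<close> by (simp add: field_simps power2_eq_square)
    then show ?thesis using False \<open>K > 0\<close> by auto
  qed (use assms in auto)
  have "\<bar>(LINT x|M. \<bar>f x\<bar> powr p) - (LINT x|M. min (\<bar>f x\<bar> powr p) K)\<bar> =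
      \<bar>LINT x|M. \<bar>f x\<bar> powr p - min (\<bar>f x\<bar> powr p) K\<bar>"
    using * ** by simp
  also have "\<dots> \<le> (LINT x|M. \<bar>f x\<bar> powr (2 * p) / K)"
  proof (intro integral_abs_bound[THEN order_trans] integral_mono)
    show "\<bar>\<bar>f x\<bar> powr p - min (\<bar>f x\<bar> powr p) K\<bar> \<le> \<bar>f x\<bar> powr (2 * p) / K" for x
      unfolding sq by (rule bd) simp
  qed (use * ** int in auto)
  finally show "\<bar>(LINT x|M. \<bar>f x\<bar> powr p) - (LINT x|M. min (\<bar>f x\<bar> powr p) K)\<bar>
           \<le> (LINT x|M. \<bar>f x\<bar> powr (2 * p)) / K"
    by simp
qed

text \<open>The truncated power is bounded and continuous, so weak convergence applies to it. The
  common bound on the 2p-th moments makes the truncation error small uniformly in n, and three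
  errors of size e / 3 add up.\<close>

lemma weak_conv_imp_moments_converge:
  fixes p B :: real
  assumes \<mu>: "\<And>n. real_distribution (\<mu> n)" and M: "real_distribution M"
    and conv: "weak_conv_m \<mu> M" and "p > 0"
    and int: "\<And>n. integrable (\<mu> n) (\<lambda>y. \<bar>y\<bar> powr (2 * p))"
    and bound: "\<And>n. (LINT y|\<mu> n. \<bar>y\<bar> powr (2 * p)) \<le> B"
    and int': "integrable M (\<lambda>y. \<bar>y\<bar> powr (2 * p))"
  shows "(\<lambda>n. LINT y|\<mu> n. \<bar>y\<bar> powr p) \<longlonglongrightarrow> (LINT y|M. \<bar>y\<bar> powr p)"
proof (rule LIMSEQ_I)
  fix e :: real assume "e > 0"
  \<comment> \<open>C dominates the 2p-th moments of all the measures and of the limit; the 1 keeps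
    it positive, so that K is positive too.\<close>
  define C where "C = max 1 (max B (LINT y|M. \<bar>y\<bar> powr (2 * p)))"
  define K where "K = 3 * C / e"
  have "C > 0"
    unfolding C_def by linarith
  then have "K > 0" "C / K = e / 3"
    using \<open>e > 0\<close> by (simp_all add: K_def)
  have trunc: "norm ((LINT y|\<nu>. \<bar>y\<bar> powr p) - (LINT y|\<nu>. min (\<bar>y\<bar> powr p) K)) \<le> e / 3"
    if "real_distribution \<nu>" "integrable \<nu> (\<lambda>y. \<bar>y\<bar> powr (2 * p))" "integral\<^sup>L \<nu> (\<lambda>y. \<bar>y\<bar> powr (2 * p)) \<le> C" for \<nu>
  proof -
    note nu = that
    have "prob_space \<nu>"
      using nu(1) by (simp add: real_distribution_def)
    moreover have "(\<lambda>y. y) \<in> borel_measurable \<nu>"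
      using nu(1) by (simp add: real_distribution.events_eq_borel measurable_ident_sets)
    ultimately have "norm ((LINT y|\<nu>. \<bar>y\<bar> powr p) - (LINT y|\<nu>. min (\<bar>y\<bar> powr p) K))
        \<le> integral\<^sup>L \<nu> (\<lambda>y. \<bar>y\<bar> powr (2 * p)) / K"
      unfolding real_norm_def
      by (rule expectation_truncated_powr(2)) (fact \<open>p > 0\<close> \<open>K > 0\<close> nu(2))+
    also have "integral\<^sup>L \<nu> (\<lambda>y. \<bar>y\<bar> powr (2 * p)) / K \<le> C / K"
      using nu(3) \<open>K > 0\<close> by (rule divide_right_mono[OF _ less_imp_le])
    finally show ?thesis
      unfolding \<open>C / K = e / 3\<close> .
  qed
  have "(\<lambda>n. LINT y|\<mu> n. min (\<bar>y\<bar> powr p) K) \<longlonglongrightarrow> (LINT y|M. min (\<bar>y\<bar> powr p) K)"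
  proof (rule weak_conv_imp_integral_bdd_continuous_conv[OF \<mu> M conv])
    show "isCont (\<lambda>y. min (\<bar>y\<bar> powr p) K) y" for y
      unfolding isCont_def using \<open>p > 0\<close> by (intro tendsto_min tendsto_powr' tendsto_intros) auto
    show "norm (min (\<bar>y\<bar> powr p) K) \<le> K" for y
      using \<open>K > 0\<close> by (auto simp: min_def)
  qed
  from LIMSEQ_D[OF this, of "e / 3"] \<open>e > 0\<close> obtain n0 where n0: "\<And>n. n \<ge> n0 \<Longrightarrow>
      norm ((LINT y|\<mu> n. min (\<bar>y\<bar> powr p) K) - (LINT y|M. min (\<bar>y\<bar> powr p) K)) < e / 3"
    by auto
  have "norm ((LINT y|\<mu> n. \<bar>y\<bar> powr p) - (LINT y|M. \<bar>y\<bar> powr p)) < e" if "n \<ge> n0" for n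
  proof -
    have "norm ((LINT y|\<mu> n. \<bar>y\<bar> powr p) - (LINT y|\<mu> n. min (\<bar>y\<bar> powr p) K)) \<le> e / 3"
      using bound[of n] by (intro trunc \<mu> int) (simp add: C_def)
    moreover have "norm ((LINT y|M. \<bar>y\<bar> powr p) - (LINT y|M. min (\<bar>y\<bar> powr p) K)) \<le> e / 3"
      by (intro trunc M int') (simp add: C_def)
    ultimately show ?thesis
      using n0[OF that] unfolding real_norm_def by linarith
  qed
  then show "\<exists>n0. \<forall>n\<ge>n0. norm ((LINT y|\<mu> n. \<bar>y\<bar> powr p) - (LINT y|M. \<bar>y\<bar> powr p)) < e"
    by blast
qed

section \<open>Products of cosines and Gaussian bounds\<close>

lemma exp_minus_le_quadratic:
  fixes v :: real
  assumes "v \<ge> 0"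
  shows "exp (- v) \<le> 1 - v + v\<^sup>2 / 2"
proof -
  have "\<exists>t. \<bar>t\<bar> \<le> \<bar>- v\<bar> \<and> exp (- v) = (\<Sum>m<3. (- v) ^ m / fact m) + exp t / fact 3 * (- v) ^ 3"
    using Maclaurin_exp_le[of "- v" 3] by simp
  then obtain t where "exp (- v) = (\<Sum>m<3. (- v) ^ m / fact m) + exp t / fact 3 * (- v) ^ 3" by blast
  moreover have "exp t * v ^ 3 \<ge> 0" using assms by simp
  ultimately show ?thesis by (simp add: eval_nat_numeral)
qed

text \<open>Both functions agree with 1 - u^2 / 2, up to u^4 / 24 for the cosine and u^4 / 8 for the
  exponential.\<close>

lemma abs_cos_minus_exp_le: "\<bar>cos u - exp (- u\<^sup>2 / 2)\<bar> \<le> u ^ 4" for u :: real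
proof -
  obtain t where "cos u = (\<Sum>m<4. cos_coeff m * u ^ m) + cos (t + 1 / 2 * real 4 * pi) / fact 4 * u ^ 4"
    using Maclaurin_cos_expansion[of u 4] by blast
  then have "cos u = 1 - u\<^sup>2 / 2 + cos (t + 2 * pi) / 24 * u ^ 4"
    by (simp add: cos_coeff_def lessThan_nat_numeral lessThan_Suc fact_numeral)
  then have "\<bar>cos u - (1 - u\<^sup>2 / 2)\<bar> = \<bar>cos (t + 2 * pi)\<bar> * (u ^ 4 / 24)"
    by (simp add: abs_mult)
  also have "\<dots> \<le> 1 * (u ^ 4 / 24)"
    by (intro mult_right_mono) auto
  finally have 1: "\<bar>cos u - (1 - u\<^sup>2 / 2)\<bar> \<le> u ^ 4 / 24" by simp
  have 2: "\<bar>exp (- (u\<^sup>2 / 2)) - (1 - u\<^sup>2 / 2)\<bar> \<le> u ^ 4 / 8"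
    using exp_ge_add_one_self[of "- (u\<^sup>2 / 2)"] exp_minus_le_quadratic[of "u\<^sup>2 / 2"]
    by (simp add: power_divide)
  have "0 \<le> u ^ 4" by simp
  then show ?thesis using 1 2 unfolding minus_divide_left by argo
qed

text \<open>All factors have modulus at most 1, so replacing each cosine by its Gaussian counterpart
  costs at most the sum of the individual differences. Each is at most (C / sqrt N)^4, and N of them
  amount to C^4 / N.\<close>

lemma prod_cos_tendsto:
  fixes a :: "nat \<Rightarrow> nat \<Rightarrow> real"
  assumes bound: "\<And>N j. \<bar>a N j\<bar> \<le> C / sqrt N"
    and lim: "(\<lambda>N. \<Sum>j<N. (a N j)\<^sup>2) \<longlonglongrightarrow> v"
  shows "(\<lambda>N. \<Prod>j<N. cos (a N j)) \<longlonglongrightarrow> exp (- v / 2)"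
proof -
  have "(\<lambda>N. exp (- (\<Sum>j<N. (a N j)\<^sup>2) / 2)) \<longlonglongrightarrow> exp (- v / 2)"
    by (intro tendsto_intros lim) auto
  moreover have "(\<lambda>N. (\<Prod>j<N. cos (a N j)) - exp (- (\<Sum>j<N. (a N j)\<^sup>2) / 2)) \<longlonglongrightarrow> 0"
  proof (rule Lim_null_comparison)
    show "(\<lambda>N. C ^ 4 / real N) \<longlonglongrightarrow> 0"
      by (rule lim_const_over_n)
    show "\<forall>\<^sub>F N in sequentially. norm ((\<Prod>j<N. cos (a N j)) - exp (- (\<Sum>j<N. (a N j)\<^sup>2) / 2))
        \<le> C ^ 4 / real N"
      using eventually_gt_at_top[of 0]
    proof eventually_elim
      case (elim N)
      have "exp (- (\<Sum>j<N. (a N j)\<^sup>2) / 2) = (\<Prod>j<N. exp (- (a N j)\<^sup>2 / 2))"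
        by (simp add: exp_sum[symmetric] sum_negf sum_divide_distrib)
      then have "norm ((\<Prod>j<N. cos (a N j)) - exp (- (\<Sum>j<N. (a N j)\<^sup>2) / 2)) \<le>
          (\<Sum>j<N. norm (cos (a N j) - exp (- (a N j)\<^sup>2 / 2)))"
        by (simp only:) (rule norm_prod_diff, auto)
      also have "\<dots> \<le> (\<Sum>j<N. (C / sqrt N) ^ 4)"
      proof (rule sum_mono)
        fix j
        have "\<bar>a N j\<bar> ^ 4 \<le> (C / sqrt N) ^ 4"
          by (intro power_mono bound) auto
        then show "norm (cos (a N j) - exp (- (a N j)\<^sup>2 / 2)) \<le> (C / sqrt N) ^ 4"
          using abs_cos_minus_exp_le[of "a N j"] by (simp add: power_even_abs)
      qed
      also have "\<dots> = C ^ 4 / real N"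
        using elim by (simp add: power_divide eval_nat_numeral field_simps)
      finally show ?case .
    qed
  qed
  ultimately show ?thesis
    by (rule Lim_transform)
qed

text \<open>The exponent is not sharp, but any Gaussian bound serves the moment estimate, and this
  one follows by splitting at |u| = 1.\<close>

lemma cosh_le_exp_square: "cosh u \<le> exp (u\<^sup>2)" for u :: real
proof (cases "\<bar>u\<bar> \<le> 1")
  case True
  have "cosh \<bar>u\<bar> \<le> 1 + u\<^sup>2"
  proof -
    have "exp (- \<bar>u\<bar>) \<le> 1 - \<bar>u\<bar> + u\<^sup>2" "exp \<bar>u\<bar> \<le> 1 + \<bar>u\<bar> + u\<^sup>2"
      using exp_bound[of "\<bar>u\<bar>"] exp_minus_le_quadratic[of "\<bar>u\<bar>"] zero_le_power2[of u] True
      unfolding power2_abs by linarith+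
    then show ?thesis by (simp add: cosh_def)
  qed
  also have "\<dots> \<le> exp (u\<^sup>2)" by (rule exp_ge_add_one_self)
  finally show ?thesis by (auto simp: abs_if split: if_splits)
next
  case False
  have "cosh u \<le> exp \<bar>u\<bar>"
    by (cases "u \<ge> 0") (auto simp: cosh_def)
  also have "\<bar>u\<bar> \<le> u\<^sup>2"
    using False self_le_power[of "\<bar>u\<bar>" 2] by auto
  finally show ?thesis by simp
qed

section \<open>Averages of exponentials and of squared sines\<close>

lemma average_cis_tendsto_0:
  assumes "cis a \<noteq> 1"
  shows "(\<lambda>N. (\<Sum>j<N. cis (a * real j)) / real N) \<longlonglongrightarrow> 0"
proof (rule Lim_null_comparison)
  show "(\<lambda>N. (2 / norm (cis a - 1)) / real N) \<longlonglongrightarrow> 0"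
    by (rule lim_const_over_n)
  have "norm ((\<Sum>j<N. cis (a * real j)) / real N) \<le> (2 / norm (cis a - 1)) / real N" for N
  proof -
    have "(\<Sum>j<N. cis (a * real j)) = (\<Sum>j<N. cis a ^ j)"
      by (simp add: Complex.DeMoivre mult.commute)
    also have "\<dots> = (cis a ^ N - 1) / (cis a - 1)"
      using assms by (rule geometric_sum)
    also have "norm \<dots> \<le> 2 / norm (cis a - 1)"
      unfolding norm_divide by (intro divide_right_mono norm_triangle_ineq4[THEN order_trans])
        (auto simp: norm_power)
    finally show ?thesis unfolding norm_divide by (simp add: divide_right_mono del: divide_divide_eq_left)
  qed
  then show "\<forall>\<^sub>F N in sequentially. norm ((\<Sum>j<N. cis (a * real j)) / real N) \<le> (2 / norm (cis a - 1)) / real N"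
    by simp
qed

text \<open>The double-angle formula leaves 1 / 2 minus half an average of cosines, which is the
  real part of a nonresonant geometric average and vanishes in the limit. The phase 2 * a + 2 * b
  contains 2 * a because the frequencies start at \<open>Suc 0\<close>.\<close>

lemma average_sin_square_tendsto:
  assumes "cis (2 * a) \<noteq> 1"
  shows "(\<lambda>N. (\<Sum>j<N. (sin (a * real (Suc j) + b))\<^sup>2) / real N) \<longlonglongrightarrow> 1 / 2"
proof -
  have "(\<lambda>N. 1 / 2 - Re (cis (2 * a + 2 * b) * ((\<Sum>j<N. cis (2 * a * real j)) / real N)) / 2)
      \<longlonglongrightarrow> 1 / 2 - Re (cis (2 * a + 2 * b) * 0) / 2"
    by (intro tendsto_intros average_cis_tendsto_0 assms) auto
  then have "(\<lambda>N. 1 / 2 - Re (cis (2 * a + 2 * b) * ((\<Sum>j<N. cis (2 * a * real j)) / real N)) / 2)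
      \<longlonglongrightarrow> 1 / 2" by simp
  then show ?thesis
  proof (rule Lim_transform_eventually)
    show "\<forall>\<^sub>F N in sequentially.
      1 / 2 - Re (cis (2 * a + 2 * b) * ((\<Sum>j<N. cis (2 * a * real j)) / real N)) / 2 =
      (\<Sum>j<N. (sin (a * real (Suc j) + b))\<^sup>2) / real N"
      using eventually_gt_at_top[of 0]
    proof eventually_elim
      case (elim N)
      have "(sin (a * real (Suc j) + b))\<^sup>2 = 1 / 2 - Re (cis (2 * a + 2 * b) * cis (2 * a * real j)) / 2" for j
        using cos_double_sin[of "a * real (Suc j) + b"] by (simp add: cis_mult algebra_simps)
      then have "(\<Sum>j<N. (sin (a * real (Suc j) + b))\<^sup>2) =
          real N / 2 - Re (cis (2 * a + 2 * b) * (\<Sum>j<N. cis (2 * a * real j))) / 2"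
        by (simp only: sum_subtractf sum_divide_distrib[symmetric] sum_distrib_left Re_sum) simp
      then show ?case
        using elim by (simp add: diff_divide_distrib)
    qed
  qed
qed

section \<open>Random trigonometric polynomials with uncorrelated signs\<close>

text \<open>Together these conditions characterize independent fair signs. The multilinear
  formulation is the one that the Chowla hypothesis delivers directly, and the one that expanding
  products calls for.\<close>

locale uncorrelated_signs = prob_space M for M :: "'a measure" +
  fixes X :: "nat \<Rightarrow> 'a \<Rightarrow> real"
  assumes measurable_X [measurable]: "\<And>j. X j \<in> borel_measurable M"
    and sign: "\<And>\<omega> j. \<omega> \<in> space M \<Longrightarrow> X j \<omega> \<in> {- 1, 1}"
    and uncorrelated: "\<And>A. finite A \<Longrightarrow> A \<noteq> {} \<Longrightarrow> expectation (\<lambda>\<omega>. \<Prod>j\<in>A. X j \<omega>) = 0"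
begin

section \<open>Products and exponentials of signed sums\<close>

lemma abs_X [simp]: "\<omega> \<in> space M \<Longrightarrow> \<bar>X j \<omega>\<bar> = 1"
  using sign[of \<omega> j] by auto

lemma integrable_prod_X [simp]: "integrable M (\<lambda>\<omega>. \<Prod>j\<in>A. X j \<omega>)"
  by (rule integrable_const_bound[of _ 1]) (auto simp: abs_prod)

text \<open>Expand the product over subsets of J: every nonempty subset contributes a correlation,
  hence zero, and the empty one leaves the product of the constants. The general field covers both
  the complex exponentials and the real ones.\<close>

lemma expectation_prod_affine:
  fixes c d :: "nat \<Rightarrow> 'b :: {real_normed_field, banach, second_countable_topology}"
  assumes "finite J"
  shows "(LINT \<omega>|M. (\<Prod>j\<in>J. c j + of_real (X j \<omega>) * d j)) = (\<Prod>j\<in>J. c j)"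
proof -
  have "(LINT \<omega>|M. (\<Prod>j\<in>J. c j + of_real (X j \<omega>) * d j)) =
      (LINT \<omega>|M. (\<Sum>A\<in>Pow J. (\<Prod>j\<in>A. X j \<omega>) *\<^sub>R (prod d A * prod c (J - A))))"
  proof (rule Bochner_Integration.integral_cong[OF refl])
    fix \<omega>
    have "(\<Prod>j\<in>J. of_real (X j \<omega>) * d j + c j) =
        (\<Sum>A\<in>Pow J. (\<Prod>j\<in>A. of_real (X j \<omega>) * d j) * prod c (J - A))"
      by (rule prod_add[OF assms])
    then show "(\<Prod>j\<in>J. c j + of_real (X j \<omega>) * d j) =
        (\<Sum>A\<in>Pow J. (\<Prod>j\<in>A. X j \<omega>) *\<^sub>R (prod d A * prod c (J - A)))"
      by (simp add: add.commute prod.distrib scaleR_conv_of_real mult.assoc)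
  qed
  also have "\<dots> = (\<Sum>A\<in>Pow J. expectation (\<lambda>\<omega>. \<Prod>j\<in>A. X j \<omega>) *\<^sub>R (prod d A * prod c (J - A)))"
    by simp
  also have "\<dots> = (\<Sum>A\<in>{{}}. expectation (\<lambda>\<omega>. \<Prod>j\<in>A. X j \<omega>) *\<^sub>R (prod d A * prod c (J - A)))"
    using assms by (intro sum.mono_neutral_right) (auto intro: uncorrelated finite_subset)
  also have "\<dots> = prod c J"
    by (simp add: prob_space)
  finally show ?thesis .
qed

text \<open>A function of a sign is affine in it: its even part is the constant and its odd part the
  slope. For the imaginary exponential these are the cosine and i times the sine.\<close>

lemma expectation_iexp:
  assumes "finite J"
  shows "(LINT \<omega>|M. iexp (\<Sum>j\<in>J. X j \<omega> * b j)) = of_real (\<Prod>j\<in>J. cos (b j))"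
proof -
  have "(LINT \<omega>|M. iexp (\<Sum>j\<in>J. X j \<omega> * b j)) =
      (LINT \<omega>|M. (\<Prod>j\<in>J. of_real (cos (b j)) + of_real (X j \<omega>) * (\<i> * of_real (sin (b j)))))"
  proof (rule Bochner_Integration.integral_cong[OF refl])
    fix \<omega> assume \<omega>: "\<omega> \<in> space M"
    have iexp_cis: "iexp y = cis y" for y
      by (simp add: cis_conv_exp)
    have "iexp (X j \<omega> * b j) = of_real (cos (b j)) + of_real (X j \<omega>) * (\<i> * of_real (sin (b j)))" for j
      unfolding iexp_cis
      using sign[OF \<omega>, of j] by (auto simp: complex_eq_iff)
    then show "iexp (\<Sum>j\<in>J. X j \<omega> * b j) =
        (\<Prod>j\<in>J. of_real (cos (b j)) + of_real (X j \<omega>) * (\<i> * of_real (sin (b j))))"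
      using assms by (simp add: sum_distrib_left exp_sum)
  qed
  also have "\<dots> = (\<Prod>j\<in>J. of_real (cos (b j)))"
    by (rule expectation_prod_affine[OF assms])
  finally show ?thesis by simp
qed

lemma expectation_exp:
  assumes "finite J"
  shows "expectation (\<lambda>\<omega>. exp (\<Sum>j\<in>J. X j \<omega> * b j)) = (\<Prod>j\<in>J. cosh (b j))"
proof -
  have "expectation (\<lambda>\<omega>. exp (\<Sum>j\<in>J. X j \<omega> * b j)) =
      expectation (\<lambda>\<omega>. \<Prod>j\<in>J. cosh (b j) + of_real (X j \<omega>) * sinh (b j))"
  proof (rule Bochner_Integration.integral_cong[OF refl])
    fix \<omega> assume \<omega>: "\<omega> \<in> space M"
    have "exp (X j \<omega> * b j) = cosh (b j) + of_real (X j \<omega>) * sinh (b j)" for j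
      using sign[OF \<omega>, of j] by (auto simp: cosh_plus_sinh cosh_minus_sinh)
    then show "exp (\<Sum>j\<in>J. X j \<omega> * b j) = (\<Prod>j\<in>J. cosh (b j) + of_real (X j \<omega>) * sinh (b j))"
      using assms by (simp add: exp_sum)
  qed
  also have "\<dots> = (\<Prod>j\<in>J. cosh (b j))"
    by (rule expectation_prod_affine[OF assms])
  finally show ?thesis .
qed

lemma abs_weighted_sum_le:
  assumes "\<omega> \<in> space M"
  shows "\<bar>\<Sum>j\<in>J. X j \<omega> * b j\<bar> \<le> (\<Sum>j\<in>J. \<bar>b j\<bar>)"
  using sum_abs[of "\<lambda>j. X j \<omega> * b j" J] assms by (simp add: abs_mult)

text \<open>Bound exp |S| by exp S + exp (- S); each term has the product of hyperbolic cosines as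
  its expectation.\<close>

lemma expectation_exp_abs_le:
  assumes "finite J"
  shows "expectation (\<lambda>\<omega>. exp \<bar>\<Sum>j\<in>J. X j \<omega> * b j\<bar>) \<le> 2 * exp (\<Sum>j\<in>J. (b j)\<^sup>2)"
proof -
  have int: "integrable M (\<lambda>\<omega>. exp (\<Sum>j\<in>J. X j \<omega> * b j))" for b
    by (rule integrable_const_bound[of _ "exp (\<Sum>j\<in>J. \<bar>b j\<bar>)"])
      (use abs_weighted_sum_le[of _ b J] in \<open>auto dest: abs_le_D1\<close>)
  have int': "integrable M (\<lambda>\<omega>. exp \<bar>\<Sum>j\<in>J. X j \<omega> * b j\<bar>)"
    by (rule integrable_const_bound[of _ "exp (\<Sum>j\<in>J. \<bar>b j\<bar>)"])
      (use abs_weighted_sum_le[of _ b J] in auto)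
  have "expectation (\<lambda>\<omega>. exp \<bar>\<Sum>j\<in>J. X j \<omega> * b j\<bar>) \<le>
      expectation (\<lambda>\<omega>. exp (\<Sum>j\<in>J. X j \<omega> * b j) + exp (\<Sum>j\<in>J. X j \<omega> * - b j))"
    by (intro integral_mono int' Bochner_Integration.integrable_add int) (auto simp: abs_if sum_negf)
  also have "\<dots> = 2 * (\<Prod>j\<in>J. cosh (b j))"
    using expectation_exp[OF assms, of b] expectation_exp[OF assms, of "\<lambda>j. - b j"]
    by (subst Bochner_Integration.integral_add[OF int int]) simp
  also have "(\<Prod>j\<in>J. cosh (b j)) \<le> (\<Prod>j\<in>J. exp ((b j)\<^sup>2))"
    by (intro prod_mono) (simp add: cosh_le_exp_square)
  also have "\<dots> = exp (\<Sum>j\<in>J. (b j)\<^sup>2)"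
    using assms by (simp add: exp_sum)
  finally show ?thesis by simp
qed

section \<open>The trigonometric sum projected onto a random line\<close>

definition trig_sum :: "nat \<Rightarrow> 'a \<Rightarrow> real \<Rightarrow> complex" where
  "trig_sum N \<omega> t = (\<Sum>j<N. of_real (X j \<omega>) * cis (2 * pi * t) ^ Suc j)"

text \<open>The pair u holds the position t on the circle and the direction. The factor 2 under the
  root compensates for the mean 1 / 2 of a squared sine, so that the limiting variance is 1.\<close>

definition projection_coeff :: "nat \<Rightarrow> real \<times> real \<Rightarrow> nat \<Rightarrow> real" where
  "projection_coeff N u j = sqrt (2 / real N) * sin (2 * pi * fst u * real (Suc j) + pi * snd u)"

definition projection :: "nat \<Rightarrow> 'a \<times> real \<times> real \<Rightarrow> real" where
  "projection N = (\<lambda>(\<omega>, u). \<Sum>j<N. X j \<omega> * projection_coeff N u j)"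

definition joint :: "('a \<times> real \<times> real) measure" where
  "joint = M \<Otimes>\<^sub>M (unit_uniform \<Otimes>\<^sub>M unit_uniform)"

lemma projection_conv_trig_sum:
  "projection N (\<omega>, t, \<theta>) = sqrt (2 / real N) * Im (trig_sum N \<omega> t * cis (pi * \<theta>))"
proof -
  have "cis (2 * pi * t) ^ Suc j * cis (pi * \<theta>) = cis (2 * pi * t * real (Suc j) + pi * \<theta>)" for j
    unfolding Complex.DeMoivre cis_mult by (simp only: mult.commute)
  then have "Im (trig_sum N \<omega> t * cis (pi * \<theta>)) =
      (\<Sum>j<N. X j \<omega> * sin (2 * pi * t * real (Suc j) + pi * \<theta>))"
    by (simp add: trig_sum_def sum_distrib_right mult.assoc Im_sum del: power_Suc)
  then show ?thesis
    by (simp add: projection_def projection_coeff_def sum_distrib_left mult_ac)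
qed

lemma projection_coeff_le: "\<bar>projection_coeff N u j\<bar> \<le> sqrt 2 / sqrt (real N)"
  using mult_left_mono[OF abs_sin_le_one, of "sqrt (2 / real N)"]
  by (simp add: projection_coeff_def abs_mult real_sqrt_divide)

lemma measurable_projection [measurable]: "projection N \<in> borel_measurable joint"
  unfolding projection_def projection_coeff_def joint_def by measurable

lemma space_joint: "space joint = space M \<times> UNIV"
  by (simp add: joint_def space_pair_measure)

text \<open>A crude bound for fixed N, used to justify integrability; the estimates uniform in N
  come from \<open>expectation_exp_abs_le\<close>.\<close>

lemma abs_projection_le:
  assumes "\<omega> \<in> space joint"
  shows "\<bar>projection N \<omega>\<bar> \<le> real N * sqrt 2"
proof -
  have "\<bar>projection N \<omega>\<bar> \<le> (\<Sum>j<N. \<bar>projection_coeff N (snd \<omega>) j\<bar>)"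
    using assms abs_weighted_sum_le[of "fst \<omega>" "projection_coeff N (snd \<omega>)" "{..<N}"]
    by (cases \<omega>) (simp add: projection_def space_joint)
  also have "\<dots> \<le> (\<Sum>j<N. sqrt 2)"
  proof (rule sum_mono)
    fix j assume "j \<in> {..<N}"
    then have "sqrt 2 / sqrt (real N) \<le> sqrt 2 / 1"
      by (intro divide_left_mono) auto
    then show "\<bar>projection_coeff N (snd \<omega>) j\<bar> \<le> sqrt 2"
      using projection_coeff_le[of N "snd \<omega>" j] by linarith
  qed
  finally show ?thesis by simp
qed

interpretation U: pair_prob_space unit_uniform unit_uniform
  using prob_space_unit_uniform by (auto simp: pair_prob_space_def pair_sigma_finite_def prob_space_imp_sigma_finite)

interpretation Q: pair_prob_space M "unit_uniform \<Otimes>\<^sub>M unit_uniform"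
  by (simp add: pair_prob_space_def pair_sigma_finite_def prob_space_imp_sigma_finite
    prob_space_axioms U.prob_space_axioms)

lemma prob_space_joint: "prob_space joint"
  unfolding joint_def by (rule Q.prob_space_axioms)

text \<open>Fubini is used in two orders. Integrating the signs first, as here, yields products over
  j; integrating the direction first, as in \<open>integral_joint_outer\<close>, recovers the
  modulus of the sum.\<close>

lemma integral_joint_inner:
  fixes f :: "'a \<times> real \<times> real \<Rightarrow> 'b :: {banach, second_countable_topology}"
  assumes "integrable joint f"
  shows "integral\<^sup>L joint f = (LINT u|(unit_uniform \<Otimes>\<^sub>M unit_uniform). LINT \<omega>|M. f (\<omega>, u))"
  using Q.integral_snd[of "\<lambda>\<omega> u. f (\<omega>, u)"] assms by (simp add: joint_def)

lemma integral_joint_outer: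
  fixes f :: "'a \<times> real \<times> real \<Rightarrow> real"
  assumes "f \<in> borel_measurable joint" "\<And>\<omega>. \<omega> \<in> space joint \<Longrightarrow> \<bar>f \<omega>\<bar> \<le> B"
  shows "integral\<^sup>L joint f = (LINT \<omega>|M. LINT t|unit_uniform. LINT \<theta>|unit_uniform. f (\<omega>, t, \<theta>))"
proof -
  note [measurable] = assms(1)[unfolded joint_def]
  have "integrable joint f"
    using prob_space_joint assms by (intro finite_measure.integrable_const_bound[of _ _ B])
      (auto intro: prob_space.finite_measure)
  then have "integral\<^sup>L joint f = (LINT \<omega>|M. LINT u|(unit_uniform \<Otimes>\<^sub>M unit_uniform). f (\<omega>, u))"
    using Q.integral_fst[of "\<lambda>\<omega> u. f (\<omega>, u)"] by (simp add: joint_def)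
  also have "\<dots> = (LINT \<omega>|M. LINT t|unit_uniform. LINT \<theta>|unit_uniform. f (\<omega>, t, \<theta>))"
  proof (rule Bochner_Integration.integral_cong[OF refl])
    fix \<omega> assume \<omega>: "\<omega> \<in> space M"
    have "integrable (unit_uniform \<Otimes>\<^sub>M unit_uniform) (\<lambda>u. f (\<omega>, u))"
      using \<omega> assms(2) by (intro U.integrable_const_bound[of _ B]) (auto simp: space_joint)
    then show "(LINT u|(unit_uniform \<Otimes>\<^sub>M unit_uniform). f (\<omega>, u)) =
        (LINT t|unit_uniform. LINT \<theta>|unit_uniform. f (\<omega>, t, \<theta>))"
      by (rule U.integral_fst'[symmetric])
  qed
  finally show ?thesis .
qed

text \<open>For a fixed point and fixed z, averaging over the direction gives the p-th power of the
  modulus times the sine constant; \<open>2 powr (p / 2)\<close> is the p-th power of the scaling by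
  sqrt 2.\<close>

lemma expectation_projection_powr:
  assumes "p > 0"
  shows "(LINT \<omega>|joint. \<bar>projection N \<omega>\<bar> powr p) =
    2 powr (p / 2) * (Gamma ((p + 1) / 2) / (sqrt pi * Gamma (p / 2 + 1))) *
    (LINT \<omega>|M. LINT t|unit_uniform. norm (1 / sqrt (real N) * trig_sum N \<omega> t) powr p)"
    (is "_ = _ * ?K * _")
proof -
  have inner: "(LINT \<theta>|unit_uniform. \<bar>projection N (\<omega>, t, \<theta>)\<bar> powr p) =
      2 powr (p / 2) * ?K * norm (1 / sqrt (real N) * trig_sum N \<omega> t) powr p" for \<omega> t
  proof -
    have "(LINT \<theta>|unit_uniform. \<bar>projection N (\<omega>, t, \<theta>)\<bar> powr p) =
        (LINT \<theta>|unit_uniform. \<bar>Im (of_real (sqrt (2 / real N)) * trig_sum N \<omega> t * cis (pi * \<theta>))\<bar> powr p)"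
      unfolding projection_conv_trig_sum by (simp add: mult.assoc)
    also have "\<dots> = norm (of_real (sqrt (2 / real N)) * trig_sum N \<omega> t) powr p * ?K"
      using assms by (intro integral_unit_uniform has_integral_Im_rotation_powr) auto
    also have "norm (of_real (sqrt (2 / real N)) * trig_sum N \<omega> t) =
        sqrt 2 * norm (1 / sqrt (real N) * trig_sum N \<omega> t)"
      by (simp add: norm_mult norm_divide real_sqrt_divide)
    also have "\<dots> powr p = 2 powr (p / 2) * norm (1 / sqrt (real N) * trig_sum N \<omega> t) powr p"
      by (simp add: powr_mult powr_powr flip: powr_half_sqrt)
    finally show ?thesis by (simp add: mult_ac)
  qed
  have "(LINT \<omega>|joint. \<bar>projection N \<omega>\<bar> powr p) =
      (LINT \<omega>|M. LINT t|unit_uniform. LINT \<theta>|unit_uniform. \<bar>projection N (\<omega>, t, \<theta>)\<bar> powr p)"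
    using assms abs_projection_le[of _ N]
    by (intro integral_joint_outer[where B = "(real N * sqrt 2) powr p"]) (auto intro!: powr_mono2)
  also have "\<dots> = 2 powr (p / 2) * ?K *
      (LINT \<omega>|M. LINT t|unit_uniform. norm (1 / sqrt (real N) * trig_sum N \<omega> t) powr p)"
    by (simp only: inner integral_mult_right_zero)
  finally show ?thesis .
qed

text \<open>The squared coefficients are each at most 2 / N, so their sum is at most 2 for every u.
  The exponential moment is therefore at most 2 * exp 2 uniformly in N, and
  \<open>powr_le_exp_abs\<close> passes this on to powers.\<close>

lemma projection_moment_bound:
  assumes "q > 0"
  shows "integrable joint (\<lambda>\<omega>. \<bar>projection N \<omega>\<bar> powr q)"
    and "(LINT \<omega>|joint. \<bar>projection N \<omega>\<bar> powr q) \<le> q powr q * (2 * exp 2)"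
proof -
  interpret J: prob_space joint by (rule prob_space_joint)
  show int: "integrable joint (\<lambda>\<omega>. \<bar>projection N \<omega>\<bar> powr q)"
    using assms abs_projection_le[of _ N]
    by (intro J.integrable_const_bound[of _ "(real N * sqrt 2) powr q"]) (auto intro!: powr_mono2)
  have int': "integrable joint (\<lambda>\<omega>. exp \<bar>projection N \<omega>\<bar>)"
    using abs_projection_le[of _ N]
    by (intro J.integrable_const_bound[of _ "exp (real N * sqrt 2)"]) auto
  have coeffs: "(\<Sum>j<N. (projection_coeff N u j)\<^sup>2) \<le> 2" for u
  proof -
    have "(\<Sum>j<N. (projection_coeff N u j)\<^sup>2) \<le> (\<Sum>j<N. 2 / real N)"
    proof (rule sum_mono)
      fix j
      have "\<bar>projection_coeff N u j\<bar>\<^sup>2 \<le> (sqrt 2 / sqrt (real N))\<^sup>2"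
        by (intro power_mono projection_coeff_le) auto
      then show "(projection_coeff N u j)\<^sup>2 \<le> 2 / real N"
        by (simp add: power_divide)
    qed
    also have "\<dots> \<le> 2" by simp
    finally show ?thesis .
  qed
  have "(LINT \<omega>|joint. exp \<bar>projection N \<omega>\<bar>) =
      (LINT u|(unit_uniform \<Otimes>\<^sub>M unit_uniform). LINT \<omega>|M. exp \<bar>projection N (\<omega>, u)\<bar>)"
    by (rule integral_joint_inner[OF int'])
  also have "\<dots> \<le> (LINT u|(unit_uniform \<Otimes>\<^sub>M unit_uniform). 2 * exp 2)"
  proof (rule integral_mono)
    show "integrable (unit_uniform \<Otimes>\<^sub>M unit_uniform) (\<lambda>u. LINT \<omega>|M. exp \<bar>projection N (\<omega>, u)\<bar>)"
      using Q.integrable_snd[of "\<lambda>\<omega> u. exp \<bar>projection N (\<omega>, u)\<bar>"] int' by (simp add: joint_def case_prod_beta')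
    fix u
    have "(LINT \<omega>|M. exp \<bar>projection N (\<omega>, u)\<bar>) \<le> 2 * exp (\<Sum>j<N. (projection_coeff N u j)\<^sup>2)"
      unfolding projection_def prod.case by (rule expectation_exp_abs_le) simp
    also have "\<dots> \<le> 2 * exp 2"
      using coeffs[of u] by simp
    finally show "(LINT \<omega>|M. exp \<bar>projection N (\<omega>, u)\<bar>) \<le> 2 * exp 2" .
  qed simp
  also have "\<dots> = 2 * exp 2"
    by (simp add: U.prob_space)
  finally have bound: "(LINT \<omega>|joint. exp \<bar>projection N \<omega>\<bar>) \<le> 2 * exp 2" .
  have "(LINT \<omega>|joint. \<bar>projection N \<omega>\<bar> powr q) \<le> (LINT \<omega>|joint. q powr q * exp \<bar>projection N \<omega>\<bar>)"
    using assms by (intro integral_mono int integrable_mult_right int' powr_le_exp_abs)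
  also have "\<dots> \<le> q powr q * (2 * exp 2)"
    using bound by (simp add: mult_left_mono)
  finally show "(LINT \<omega>|joint. \<bar>projection N \<omega>\<bar> powr q) \<le> q powr q * (2 * exp 2)" .
qed

text \<open>The averaging lemma fails only if 4 * pi * t is a multiple of 2 * pi, which within the
  unit interval means t = 0, 1 / 2 or 1. These are finitely many points, and the direction is
  arbitrary.\<close>

lemma AE_projection_variance:
  "AE u in (unit_uniform \<Otimes>\<^sub>M unit_uniform). (\<lambda>N. \<Sum>j<N. (projection_coeff N u j)\<^sup>2) \<longlonglongrightarrow> 1"
proof -
  have lim: "(\<lambda>N. \<Sum>j<N. (projection_coeff N (t, \<theta>) j)\<^sup>2) \<longlonglongrightarrow> 1" if "t \<in> {0..1} - {0, 1 / 2, 1}" for t \<theta>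
  proof -
    have "cis (2 * (2 * pi * t)) \<noteq> 1"
    proof
      assume "cis (2 * (2 * pi * t)) = 1"
      then have "cos (2 * (2 * pi * t)) = 1"
        by (simp add: complex_eq_iff)
      then obtain k :: int where "2 * (2 * pi * t) = of_int k * 2 * pi"
        by (auto simp: cos_one_2pi_int)
      then have "2 * t = of_int k"
        by simp
      moreover from this have "0 < k" "k < 2" using that by auto
      then have "k = 1" by simp
      ultimately show False using that by auto
    qed
    from tendsto_mult_left[OF average_sin_square_tendsto[OF this, of "pi * \<theta>"], of 2]
    have "(\<lambda>N. 2 * ((\<Sum>j<N. (sin (2 * pi * t * real (Suc j) + pi * \<theta>))\<^sup>2) / real N)) \<longlonglongrightarrow> 1"
      by simp
    moreover have "(\<Sum>j<N. (projection_coeff N (t, \<theta>) j)\<^sup>2) =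
        2 * ((\<Sum>j<N. (sin (2 * pi * t * real (Suc j) + pi * \<theta>))\<^sup>2) / real N)" for N
      by (simp add: projection_coeff_def power_mult_distrib sum_distrib_left sum_divide_distrib)
    ultimately show ?thesis by simp
  qed
  have "AE t in unit_uniform. t \<in> {0..1} - {0, 1 / 2, 1}"
  proof (rule AE_uniform_measureI)
    have "AE t in lborel. t \<noteq> 0 \<and> t \<noteq> 1 / 2 \<and> t \<noteq> (1::real)"
      by (intro AE_conjI AE_lborel_singleton)
    then show "AE t in lborel. t \<in> {0..1} \<longrightarrow> t \<in> {0..1} - {0, 1 / 2, 1::real}"
      by eventually_elim auto
  qed simp
  then have "AE t in unit_uniform. AE \<theta> in unit_uniform.
      (\<lambda>N. \<Sum>j<N. (projection_coeff N (t, \<theta>) j)\<^sup>2) \<longlonglongrightarrow> 1"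
    by eventually_elim (use lim in auto)
  then show ?thesis
    by (intro U.AE_pair_measure) (simp_all only: fst_conv snd_conv, unfold projection_coeff_def, measurable)
qed

text \<open>Integrating the signs first turns the characteristic function into the mean of a product
  of cosines. This converges for almost every u, with dominating function 1.\<close>

lemma char_projection_tendsto:
  "(\<lambda>N. char (distr joint borel (projection N)) s) \<longlonglongrightarrow> char std_normal_distribution s"
proof -
  interpret J: prob_space joint by (rule prob_space_joint)
  have "char (distr joint borel (projection N)) s =
      (LINT u|(unit_uniform \<Otimes>\<^sub>M unit_uniform). of_real (\<Prod>j<N. cos (s * projection_coeff N u j)))" for N
  proof -
    have "char (distr joint borel (projection N)) s = (LINT \<omega>|joint. iexp (s * projection N \<omega>))"
      unfolding char_def by (rule integral_distr) auto
    also have "\<dots> = (LINT u|(unit_uniform \<Otimes>\<^sub>M unit_uniform). LINT \<omega>|M. iexp (s * projection N (\<omega>, u)))"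
      by (rule integral_joint_inner) (auto intro!: J.integrable_const_bound[of _ 1])
    also have "\<dots> = (LINT u|(unit_uniform \<Otimes>\<^sub>M unit_uniform). of_real (\<Prod>j<N. cos (s * projection_coeff N u j)))"
    proof (rule Bochner_Integration.integral_cong[OF refl])
      fix u
      have "s * projection N (\<omega>, u) = (\<Sum>j<N. X j \<omega> * (s * projection_coeff N u j))" for \<omega>
        by (simp add: projection_def sum_distrib_left mult_ac)
      then show "(LINT \<omega>|M. iexp (s * projection N (\<omega>, u))) =
          of_real (\<Prod>j<N. cos (s * projection_coeff N u j))"
        by (simp only: expectation_iexp finite_lessThan)
    qed
    finally show ?thesis .
  qed
  moreover have "(\<lambda>N. LINT u|(unit_uniform \<Otimes>\<^sub>M unit_uniform). complex_of_real (\<Prod>j<N. cos (s * projection_coeff N u j)))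
      \<longlonglongrightarrow> (LINT u|(unit_uniform \<Otimes>\<^sub>M unit_uniform). complex_of_real (exp (- s\<^sup>2 / 2)))"
  proof (rule integral_dominated_convergence[where w = "\<lambda>_. 1"])
    show "AE u in (unit_uniform \<Otimes>\<^sub>M unit_uniform).
        (\<lambda>N. complex_of_real (\<Prod>j<N. cos (s * projection_coeff N u j))) \<longlonglongrightarrow> complex_of_real (exp (- s\<^sup>2 / 2))"
      using AE_projection_variance
    proof eventually_elim
      case (elim u)
      have "(\<lambda>N. \<Prod>j<N. cos (s * projection_coeff N u j)) \<longlonglongrightarrow> exp (- s\<^sup>2 / 2)"
      proof (rule prod_cos_tendsto)
        show "\<bar>s * projection_coeff N u j\<bar> \<le> (\<bar>s\<bar> * sqrt 2) / sqrt (real N)" for N j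
          using mult_left_mono[OF projection_coeff_le, of "\<bar>s\<bar>"] by (simp add: abs_mult)
        show "(\<lambda>N. \<Sum>j<N. (s * projection_coeff N u j)\<^sup>2) \<longlonglongrightarrow> s\<^sup>2"
          using tendsto_mult_left[OF elim, of "s\<^sup>2"] by (simp add: power_mult_distrib sum_distrib_left)
      qed
      then show ?case by (rule tendsto_of_real)
    qed
    show "AE u in (unit_uniform \<Otimes>\<^sub>M unit_uniform).
        norm (complex_of_real (\<Prod>j<N. cos (s * projection_coeff N u j))) \<le> 1" for N
      by (auto simp: abs_prod intro!: prod_le_1 simp del: of_real_prod)
  qed (simp_all add: projection_coeff_def)
  ultimately show ?thesis
    by (simp add: char_std_normal_distribution U.prob_space)
qed

lemma Lp_mean_tendsto:
  assumes "p > 0"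
  shows "(\<lambda>N. LINT \<omega>|M. LINT t|unit_uniform. norm (1 / sqrt (real N) * trig_sum N \<omega> t) powr p)
           \<longlonglongrightarrow> Gamma (p / 2 + 1)"
proof -
  interpret J: prob_space joint by (rule prob_space_joint)
  let ?G = "Gamma ((p + 1) / 2)" and ?\<mu> = "\<lambda>N. distr joint borel (projection N)"
  have distr: "real_distribution (?\<mu> N)" for N
    by (rule J.real_distribution_distr) simp
  have "(\<lambda>N. LINT y|?\<mu> N. \<bar>y\<bar> powr p) \<longlonglongrightarrow> (LINT y|std_normal_distribution. \<bar>y\<bar> powr p)"
  proof (rule weak_conv_imp_moments_converge)
    show "weak_conv_m ?\<mu> std_normal_distribution"
      by (rule levy_continuity[OF distr real_dist_normal_dist char_projection_tendsto])
    show "integrable (?\<mu> N) (\<lambda>y. \<bar>y\<bar> powr (2 * p))"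
      "(LINT y|?\<mu> N. \<bar>y\<bar> powr (2 * p)) \<le> (2 * p) powr (2 * p) * (2 * exp 2)" for N
      using projection_moment_bound[of "2 * p" N] assms
      by (simp_all add: integrable_distr_eq integral_distr)
    show "integrable std_normal_distribution (\<lambda>y. \<bar>y\<bar> powr (2 * p))"
      using std_normal_abs_moment[of "2 * p"] assms
      by (simp add: integrable_density has_bochner_integral_iff)
  qed (use assms distr real_dist_normal_dist in auto)
  also have "(LINT y|std_normal_distribution. \<bar>y\<bar> powr p) = 2 powr (p / 2) * ?G / sqrt pi"
    using std_normal_abs_moment[OF assms] by (simp add: integral_density has_bochner_integral_iff)
  finally have "(\<lambda>N. LINT \<omega>|joint. \<bar>projection N \<omega>\<bar> powr p) \<longlonglongrightarrow> 2 powr (p / 2) * ?G / sqrt pi"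
    by (simp add: integral_distr)
  \<comment> \<open>Dividing by the constant of \<open>expectation_projection_powr\<close> isolates
    the wanted mean; on the right everything cancels except
    \<open>Gamma (p / 2 + 1)\<close>.\<close>
  then have "(\<lambda>N. (LINT \<omega>|joint. \<bar>projection N \<omega>\<bar> powr p) /
      (2 powr (p / 2) * (?G / (sqrt pi * Gamma (p / 2 + 1)))))
      \<longlonglongrightarrow> (2 powr (p / 2) * ?G / sqrt pi) / (2 powr (p / 2) * (?G / (sqrt pi * Gamma (p / 2 + 1))))"
    by (rule tendsto_divide[OF _ tendsto_const]) (use assms in \<open>auto simp: less_imp_neq[OF Gamma_real_pos, symmetric]\<close>)
  moreover have "?G > 0" "Gamma (p / 2 + 1) > 0"
    using assms by (auto intro!: Gamma_real_pos)
  ultimately show ?thesis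
    by (simp add: expectation_projection_powr[OF assms])
qed

end

section \<open>Limit points of the Liouville system\<close>

lemma abs_liouville: "n > 0 \<Longrightarrow> \<bar>liouville n\<bar> = 1"
  by (simp add: liouville_def power_abs)

lemma shift_funpow: "(shift ^^ n) x i = x (n + i)"
  by (induction n arbitrary: i) (simp_all add: shift_def)

lemma liouville_system_subset: "liouville_system \<subseteq> {x. \<forall>i. x i \<in> {- 1, 1}}"
  unfolding liouville_system_def
proof (rule closure_minimal)
  have "liouville_point i \<in> {- 1, 1}" for i
    using abs_liouville[of "Suc i"] by (auto simp: liouville_point_def abs_if split: if_splits)
  then show "range (\<lambda>n. (shift ^^ n) liouville_point) \<subseteq> {x. \<forall>i. x i \<in> {- 1, 1}}"
    by (simp add: shift_funpow image_subset_iff del: insert_iff)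
  have "{x :: nat \<Rightarrow> real. \<forall>i. x i \<in> {- 1, 1}} = (\<Inter>i. {x. x i = - 1} \<union> {x. x i = 1})"
    by auto
  also have "closed \<dots>"
    by (intro closed_INT ballI closed_Un closed_Collect_eq continuous_on_product_coordinates continuous_on_const)
  finally show "closed {x :: nat \<Rightarrow> real. \<forall>i. x i \<in> {- 1, 1}}" .
qed

text \<open>The integrals come close to that of P infinitely often and stay close to L eventually.
  With e half the gap between the two values, a common N is contradictory.\<close>

lemma weak_star_limit_point_integral_eqI:
  fixes f :: "'a :: topological_space \<Rightarrow> real"
  assumes P: "weak_star_limit_point X \<mu> P" and f: "continuous_on X f"
    and lim: "(\<lambda>N. LINT x|\<mu> N. f x) \<longlonglongrightarrow> L"
  shows "(LINT x|P. f x) = L"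
proof (rule ccontr)
  assume ne: "(LINT x|P. f x) \<noteq> L"
  define e where "e = \<bar>(LINT x|P. f x) - L\<bar> / 2"
  have "e > 0" using ne by (simp add: e_def)
  have "\<exists>\<^sub>F N in sequentially. \<forall>g\<in>{f}. \<bar>(LINT x|\<mu> N. g x) - (LINT x|P. g x)\<bar> < e"
    using P f \<open>e > 0\<close> unfolding weak_star_limit_point_def by blast
  moreover have "\<forall>\<^sub>F N in sequentially. dist (LINT x|\<mu> N. f x) L < e"
    using lim \<open>e > 0\<close> by (rule tendstoD)
  ultimately have "\<exists>\<^sub>F N in sequentially. \<bar>(LINT x|\<mu> N. f x) - (LINT x|P. f x)\<bar> < e \<and> dist (LINT x|\<mu> N. f x) L < e"
    by (auto dest: frequently_eventually_frequently)
  then obtain N where "\<bar>(LINT x|\<mu> N. f x) - (LINT x|P. f x)\<bar> < e" "dist (LINT x|\<mu> N. f x) L < e"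
    by (auto dest: frequently_ex)
  then show False
    unfolding e_def dist_real_def by (auto simp: abs_if split: if_splits)
qed

text \<open>Enumerating A by 1, ..., \<open>card A\<close> puts the product in the form of the
  hypothesis. The shifts are \<open>Suc i\<close> because coordinate \<open>i\<close> holds the
  sequence entry with index i + 1; being positive, they never meet the truncation in
  \<open>nat\<close>.\<close>

lemma chowla_correlation_tendsto_0:
  assumes chowla: "\<forall>m\<ge>1::nat. \<forall>a::nat \<Rightarrow> int. inj_on a {1..m} \<longrightarrow>
      (\<lambda>N::nat. \<Sum>n=1..N. \<Prod>i=1..m. liouville (nat (int n + a i))) \<in> o(\<lambda>N. real N)"
    and A: "finite A" "A \<noteq> {}"
  shows "(\<lambda>N. (\<Sum>n=1..N. \<Prod>i\<in>A. liouville (n + Suc i)) / real N) \<longlonglongrightarrow> 0"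
proof -
  obtain h where h: "bij_betw h {1..card A} A"
    using ex_bij_betw_nat_finite_1[OF A(1)] by blast
  have "inj_on (\<lambda>i. int (Suc (h i))) {1..card A}"
    using bij_betw_imp_inj_on[OF h] by (simp only: inj_on_def of_nat_eq_iff nat.inject)
  moreover have "card A \<ge> 1"
    using A by (simp add: Suc_le_eq card_gt_0_iff)
  ultimately have "(\<lambda>N::nat. \<Sum>n=1..N. \<Prod>i=1..card A. liouville (nat (int n + int (Suc (h i))))) \<in> o(\<lambda>N. real N)"
    using chowla by blast
  moreover have "(\<Prod>i=1..card A. liouville (nat (int n + int (Suc (h i))))) = (\<Prod>i\<in>A. liouville (n + Suc i))" for n
    unfolding of_nat_add[symmetric] nat_int by (rule prod.reindex_bij_betw[OF h])
  ultimately show ?thesis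
    by (auto dest: smalloD_tendsto)
qed

text \<open>A product of finitely many coordinates is continuous on the system, and its empirical
  integrals are the Chowla averages. They converge along all N, so every limit point inherits the
  value 0.\<close>

lemma uncorrelated_signs_limit_point:
  assumes chowla: "\<forall>m\<ge>1::nat. \<forall>a::nat \<Rightarrow> int. inj_on a {1..m} \<longrightarrow>
      (\<lambda>N::nat. \<Sum>n=1..N. \<Prod>i=1..m. liouville (nat (int n + a i))) \<in> o(\<lambda>N. real N)"
    and P: "weak_star_limit_point liouville_system empirical_measure P"
  shows "uncorrelated_signs P (\<lambda>j x. x j)"
proof -
  have sets: "sets P = sets (restrict_space borel liouville_system)" and "prob_space P"
    using P by (auto simp: weak_star_limit_point_def)
  have space: "space P = liouville_system"
    using sets_eq_imp_space_eq[OF sets] by (simp add: space_restrict_space)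
  show ?thesis
  proof (intro uncorrelated_signs.intro uncorrelated_signs_axioms.intro)
    show "prob_space P" by fact
    show "(\<lambda>x. x j) \<in> borel_measurable P" for j
      unfolding measurable_cong_sets[OF sets refl]
      by (intro measurable_restrict_space1 borel_measurable_continuous_onI continuous_on_product_coordinates)
    show "x j \<in> {- 1, 1}" if "x \<in> space P" for x j
      using that liouville_system_subset by (auto simp: space)
    show "(LINT x|P. (\<Prod>j\<in>A. x j)) = 0" if A: "finite A" "A \<noteq> {}" for A
    proof (rule weak_star_limit_point_integral_eqI[OF P])
      show cont: "continuous_on liouville_system (\<lambda>x. \<Prod>j\<in>A. x j)"
        by (intro continuous_on_prod continuous_on_subset[OF continuous_on_product_coordinates]) simp
      show "(\<lambda>N. LINT x|empirical_measure N. (\<Prod>j\<in>A. x j)) \<longlonglongrightarrow> 0"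
        unfolding integral_empirical_measure[OF cont]
        using chowla_correlation_tendsto_0[OF chowla A]
        by (simp add: shift_funpow liouville_point_def)
    qed
  qed
qed

theorem theorem7p2:
  fixes P :: "(nat \<Rightarrow> real) measure"
  assumes chowla: "\<forall>m\<ge>1::nat. \<forall>a::nat \<Rightarrow> int. inj_on a {1..m} \<longrightarrow>
      (\<lambda>N::nat. \<Sum>n=1..N. \<Prod>i=1..m. liouville (nat (int n + a i))) \<in> o(\<lambda>N. real N)"
    and limit_point: "weak_star_limit_point liouville_system empirical_measure P"
  shows "(\<forall>p\<ge>1::real.
           (\<lambda>N::nat. LINT x|P. Lp_norm p circle_measure
              (\<lambda>z. 1 / sqrt (real N) * (\<Sum>j=1..N. x (j - 1) * z ^ j)) powr p)
             \<longlonglongrightarrow> Gamma (p / 2 + 1)) \<and>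
         (\<lambda>N::nat. LINT x|P. Lp_norm 4 circle_measure
              (\<lambda>z. 1 / sqrt (real N) * (\<Sum>j=1..N. x (j - 1) * z ^ j)) powr 4)
            \<longlonglongrightarrow> Gamma 3 \<and>
         Gamma 3 = (2::real)"
proof -
  interpret uncorrelated_signs P "\<lambda>j x. x j"
    using assms by (rule uncorrelated_signs_limit_point)
  have main: "(\<lambda>N::nat. LINT x|P. Lp_norm p circle_measure
      (\<lambda>z. 1 / sqrt (real N) * (\<Sum>j=1..N. x (j - 1) * z ^ j)) powr p) \<longlonglongrightarrow> Gamma (p / 2 + 1)"
    if "p \<ge> 1" for p
  proof -
    have "Lp_norm p circle_measure (\<lambda>z. 1 / sqrt (real N) * (\<Sum>j=1..N. x (j - 1) * z ^ j)) powr p =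
        (LINT t|unit_uniform. norm (1 / sqrt (real N) * trig_sum N x t) powr p)" for N and x :: "nat \<Rightarrow> real"
    proof -
      let ?f = "\<lambda>z::complex. norm (1 / sqrt (real N) * (\<Sum>j=1..N. x (j - 1) * z ^ j)) powr p"
      \<comment> \<open>The outer power p undoes the root 1 / p, as the integral is
        nonnegative.\<close>
      have "Lp_norm p circle_measure (\<lambda>z. 1 / sqrt (real N) * (\<Sum>j=1..N. x (j - 1) * z ^ j)) powr p =
          (LINT z|circle_measure. ?f z)"
        using that by (simp add: Lp_norm_def powr_powr)
      also have "\<dots> = (LINT t|unit_uniform. ?f (cis (2 * pi * t)))"
        by (rule integral_circle_measure) simp
      \<comment> \<open>Reindexing from 1..N to j < N turns \<open>x (j - 1)\<close> into
        \<open>x j\<close> and the exponent into \<open>Suc j\<close>.\<close>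
      also have "\<dots> = (LINT t|unit_uniform. norm (1 / sqrt (real N) * trig_sum N x t) powr p)"
        by (simp add: trig_sum_def sum.atLeast1_atMost_eq)
      finally show ?thesis .
    qed
    then show ?thesis
      using Lp_mean_tendsto[of p] that by simp
  qed
  moreover have "Gamma 3 = (2 :: real)"
    using Gamma_fact[of 2, where 'a = real] by (simp add: eval_nat_numeral)
  ultimately show ?thesis
    using main[of 4] by simp
qed

end
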